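(* Let $\lambda>0$ and let $\alpha:[0,+\infty)\to(0,1)$ be a locally integrable function with Laplace transform $A(s)=\int_0^{+\infty}e^{-st}\alpha(t)\,dt$, $s>0$. Suppose that $$\lim_{t\to0^+}\alpha(t)=\alpha',\qquad \lim_{t\to+\infty}\alpha(t)=\alpha'',$$ for some $\alpha',\alpha''\in(0,1)$, and that the function $s\mapsto s^{sA(s)}$, $s>0$, is a Bernstein function. Then the solution $u_A(t)$ of the variable-order fractional relaxation equation $$D_t^{\alpha(t)}u(t)=-\lambda u(t),\qquad u(0)=1,$$ that is, the function on $(0,+\infty)$ with Laplace transform $$\int_0^{+\infty}e^{-st}u_A(t)\,dt=\frac{s^{sA(s)-1}}{\lambda+s^{sA(s)}},\qquad s>0,$$ is non-negative, non-increasing, right-continuous and such that $\lim_{t\to0^+}u_A(t)=1$.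
   Context: A function $g:(0,+\infty)\to\mathbb{R}$ is Bernstein if it is $C^\infty$, $g(x)\ge0$ for all $x>0$, and $(-1)^{n-1}g^{(n)}(x)\ge0$ for all $n\in\mathbb{N}=\{1,2,\dots\}$ and $x>0$. The (Caputo-type) fractional derivative of variable order $\alpha(t)$ (Scarpi derivative) is $D_t^{\alpha(t)}f(t)=\int_0^t\phi_A(t-\tau)f'(\tau)\,d\tau$, where $\phi_A$ is the inverse Laplace transform of $\widetilde\phi_A(s)=s^{sA(s)-1}$, $s>0$. Its Laplace transform is $s^{sA(s)}\widetilde u(s)-s^{sA(s)-1}u(0)$, where $\widetilde u(s)=\int_0^{+\infty}e^{-st}u(t)\,dt$. The relaxation equation is understood and solved in the Laplace domain, so that its solution $u_A$ is the function whose Laplace transform is $\frac{s^{sA(s)-1}}{\lambda+s^{sA(s)}}$. A function is determined by its Laplace transform up to null sets; the claim means that there is a function with this Laplace transform having the listed properties. *)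

theory Defs
  imports "HOL-Analysis.Analysis"
begin

(* The functions of the text live on (0,\<infinity>); here they are total functions on the reals
   whose values outside (0,\<infinity>) are irrelevant. Since (0,\<infinity>) is open, the iterated
   derivatives at x > 0 depend only on the values on (0,\<infinity>), and differentiability of
   all of them there is smoothness. *)
definition bernstein :: "(real \<Rightarrow> real) \<Rightarrow> bool" where
  "bernstein g \<longleftrightarrow>
     (\<forall>n. \<forall>x>0. (deriv ^^ n) g differentiable (at x)) \<and>
     (\<forall>x>0. g x \<ge> 0) \<and>
     (\<forall>n\<ge>1. \<forall>x>0. (-1) ^ (n - 1) * (deriv ^^ n) g x \<ge> 0)"

(* The value is meaningful only where the integral converges absolutely; otherwise it is 0. *)
definition laplace :: "(real \<Rightarrow> real) \<Rightarrow> real \<Rightarrow> real" where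
  "laplace f s = (LINT t:{0<..}|lebesgue. exp (- s * t) * f t)"

definition has_laplace_transform :: "(real \<Rightarrow> real) \<Rightarrow> (real \<Rightarrow> real) \<Rightarrow> bool" where
  "has_laplace_transform f F \<longleftrightarrow>
     (\<forall>s>0. set_integrable lebesgue {0<..} (\<lambda>t. exp (- s * t) * f t) \<and> laplace f s = F s)"

definition locally_integrable_nonneg :: "(real \<Rightarrow> real) \<Rightarrow> bool" where
  "locally_integrable_nonneg f \<longleftrightarrow>
     (\<forall>K. compact K \<and> K \<subseteq> {0..} \<longrightarrow> set_integrable lebesgue K f)"

(* The relaxation equation D u = - \<lambda> u, u(0) = 1, of variable order \<alpha> with Laplace transform A
   is solved in the Laplace domain: transforming it gives
   s^(s A(s)) U(s) - s^(s A(s) - 1) = - \<lambda> U(s), and a solution is a function whose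
   transform is the resulting U. This determines u up to null sets. *)
definition relaxation_solution :: "real \<Rightarrow> (real \<Rightarrow> real) \<Rightarrow> (real \<Rightarrow> real) \<Rightarrow> bool" where
  "relaxation_solution lam A u \<longleftrightarrow>
     has_laplace_transform u
       (\<lambda>s. s powr (s * A s - 1) / (lam + s powr (s * A s)))"

end

theory Submission
  imports Defs "HOL-Probability.Helly_Selection"
begin

(* Let g(s) = s^(s A(s)). Since g is Bernstein, f = lam / (lam + g) is completely monotone, and the
   transform to be inverted is (1 - f(s)) / s. By Bernstein's theorem f(s) / s is the Laplace
   transform of a distribution function F, so u = 1 - F. Bernstein's theorem is obtained from the
   convergence of the Taylor series of f at n on (0, n), which exhibits f(n (1 - exp(-s/n))) / s as
   the transform of a step function, and from Helly's selection theorem as n tends to infinity.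
   The limit of alpha at 0 keeps s A(s) away from 0 for large s, so g(s) tends to infinity, f(s)
   tends to 0, and F has no atom at 0, that is u(0+) = 1. *)

section \<open>Complete monotonicity up to a finite order\<close>

text \<open>Complete monotonicity is \<open>cm_upto n f\<close> for every \<open>n\<close>. Finite
  orders permit induction, and asking only for the existence of \<open>h\<close> avoids formulas for
  iterated derivatives of products and quotients.\<close>

primrec cm_upto :: "nat \<Rightarrow> (real \<Rightarrow> real) \<Rightarrow> bool" where
  "cm_upto 0 f \<longleftrightarrow> (\<forall>x>0. f x \<ge> 0)"
| "cm_upto (Suc n) f \<longleftrightarrow> (\<forall>x>0. f x \<ge> 0) \<and>
     (\<exists>h. (\<forall>x>0. (f has_real_derivative - h x) (at x)) \<and> cm_upto n h)"

lemma cm_upto_nonneg: "cm_upto n f \<Longrightarrow> x > 0 \<Longrightarrow> f x \<ge> 0"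
  by (cases n) auto

lemma cm_upto_cong:
  assumes "cm_upto n f" "\<And>x. x > 0 \<Longrightarrow> f x = g x"
  shows "cm_upto n g"
proof (cases n)
  case 0
  then show ?thesis using assms by auto
next
  case (Suc m)
  then obtain h where h: "\<And>x. x > 0 \<Longrightarrow> (f has_real_derivative - h x) (at x)" "cm_upto m h"
    using assms(1) by auto
  have "(g has_real_derivative - h x) (at x)" if "x > 0" for x
    by (rule has_field_derivative_transform_within_open[OF h(1)[OF that], of "{0<..}"])
       (use that assms(2) in auto)
  then show ?thesis
    using Suc h(2) assms cm_upto_nonneg[OF assms(1)] by auto
qed

lemma cm_upto_SucD: "cm_upto (Suc n) f \<Longrightarrow> cm_upto n f"
  by (induction n arbitrary: f) auto

section \<open>Closure under sums and products\<close>

lemma cm_upto_const: "c \<ge> 0 \<Longrightarrow> cm_upto n (\<lambda>x. c)"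
proof (induction n arbitrary: c)
  case (Suc n)
  have "((\<lambda>x. c) has_real_derivative - 0) (at x)" for x
    by simp
  then show ?case
    using Suc.prems Suc.IH[of 0] by (auto intro!: exI[of _ "\<lambda>x. 0"])
qed auto

lemma cm_upto_add: "cm_upto n f \<Longrightarrow> cm_upto n g \<Longrightarrow> cm_upto n (\<lambda>x. f x + g x)"
proof (induction n arbitrary: f g)
  case (Suc n)
  from Suc.prems obtain h k where
    h: "\<forall>x>0. (f has_real_derivative - h x) (at x)" "cm_upto n h" and
    k: "\<forall>x>0. (g has_real_derivative - k x) (at x)" "cm_upto n k"
    by auto
  have "((\<lambda>x. f x + g x) has_real_derivative - (h x + k x)) (at x)" if "x > 0" for x
    using DERIV_add[of f "- h x" x UNIV g "- k x"] h(1) k(1) that by simp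
  then show ?case
    using Suc.prems Suc.IH[OF h(2) k(2)] by (auto intro!: exI[of _ "\<lambda>x. h x + k x"])
qed auto

lemma cm_upto_mult: "cm_upto n f \<Longrightarrow> cm_upto n g \<Longrightarrow> cm_upto n (\<lambda>x. f x * g x)"
proof (induction n arbitrary: f g)
  case (Suc n)
  from Suc.prems obtain h k where
    h: "\<forall>x>0. (f has_real_derivative - h x) (at x)" "cm_upto n h" and
    k: "\<forall>x>0. (g has_real_derivative - k x) (at x)" "cm_upto n k"
    by auto
  have d: "((\<lambda>x. f x * g x) has_real_derivative - (h x * g x + f x * k x)) (at x)" if "x > 0" for x
    using h(1) k(1) that by (auto intro!: derivative_eq_intros)
  \<comment> \<open>\<open>h\<close> and \<open>k\<close> have order \<open>n\<close> only, so
    \<open>f\<close> and \<open>g\<close> are lowered from \<open>Suc n\<close> to \<open>n\<close>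
    before multiplying.\<close>
  have "cm_upto n (\<lambda>x. h x * g x + f x * k x)"
    by (intro cm_upto_add Suc.IH h(2) k(2) Suc.prems[THEN cm_upto_SucD])
  with d show ?case
    using Suc.prems by (auto intro!: exI[of _ "\<lambda>x. h x * g x + f x * k x"])
qed auto

text \<open>With \<open>q = p'\<close>, the derivative of \<open>f = 1 / p\<close> is \<open>- f * f * q\<close>, in which \<open>f\<close> itself is
  undifferentiated; so order \<open>n\<close> for \<open>f\<close> gives order \<open>n + 1\<close>.\<close>

lemma cm_upto_inverse:
  assumes p: "\<And>x. x > 0 \<Longrightarrow> p x > 0"
    and d: "\<And>x. x > 0 \<Longrightarrow> (p has_real_derivative q x) (at x)"
    and q: "\<And>n. cm_upto n q"
  shows "cm_upto n (\<lambda>x. 1 / p x)"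
proof (induction n)
  case 0
  then show ?case using p by (auto simp: less_imp_le)
next
  case (Suc n)
  have "((\<lambda>x. 1 / p x) has_real_derivative - (1 / p x * (1 / p x) * q x)) (at x)" if "x > 0" for x
    using d[OF that] p[OF that] by (auto intro!: derivative_eq_intros simp: field_simps)
  moreover have "cm_upto n (\<lambda>x. 1 / p x * (1 / p x) * q x)"
    by (intro cm_upto_mult Suc q)
  moreover have "\<forall>x>0. 1 / p x \<ge> 0"
    using p by (auto simp: less_imp_le)
  ultimately show ?case
    by (auto simp del: divide_nonneg_nonneg intro!: exI[of _ "\<lambda>x. 1 / p x * (1 / p x) * q x"])
qed

section \<open>From Bernstein functions to sequences of derivatives\<close>

lemma bernstein_imp_cm_deriv:
  assumes "bernstein g"
  shows "cm_upto n (deriv g)"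
proof -
  have diff: "((deriv ^^ k) g has_real_derivative (deriv ^^ Suc k) g x) (at x)" if "x > 0" for k x
    using assms that by (simp add: bernstein_def DERIV_deriv_iff_real_differentiable)
  have nonneg: "(-1) ^ k * (deriv ^^ Suc k) g x \<ge> 0" if "x > 0" for k x
    using assms that unfolding bernstein_def by (metis One_nat_def diff_Suc_1 le_add1 plus_1_eq_Suc)
  \<comment> \<open>All signed derivatives are treated at once, because the induction on the order
    passes from \<open>k\<close> to \<open>Suc k\<close>.\<close>
  have "cm_upto n (\<lambda>x. (-1) ^ k * (deriv ^^ Suc k) g x)" for k
  proof (induction n arbitrary: k)
    case 0
    then show ?case using nonneg by auto
  next
    case (Suc n)
    have "((\<lambda>x. (-1) ^ k * (deriv ^^ Suc k) g x) has_real_derivative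
             - ((-1) ^ Suc k * (deriv ^^ Suc (Suc k)) g x)) (at x)" if "x > 0" for x
      using DERIV_cmult[OF diff[OF that, of "Suc k"], of "(-1) ^ k"] by simp
    then show ?case
      using Suc[of "Suc k"] nonneg
      by (auto intro!: exI[of _ "\<lambda>x. (-1) ^ Suc k * (deriv ^^ Suc (Suc k)) g x"] simp del: funpow.simps)
  qed
  from this[of 0] show ?thesis by simp
qed

text \<open>The witnesses \<open>h\<close> for different orders are a priori different functions.
  Uniqueness of the derivative makes each agree with \<open>- deriv f\<close> on the positive axis,
  so one sequence serves every order.\<close>

lemma cm_upto_derivs:
  assumes "\<And>n. cm_upto n f"
  obtains D where "D 0 = f" "\<And>k x. x > 0 \<Longrightarrow> D k x \<ge> 0"
    "\<And>k x. x > 0 \<Longrightarrow> (D k has_real_derivative - D (Suc k) x) (at x)"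
proof -
  define D where "D = rec_nat f (\<lambda>_ h x. - deriv h x)"
  have D_Suc: "D (Suc k) = (\<lambda>x. - deriv (D k) x)" for k
    by (simp add: D_def)
  have step: "(f has_real_derivative deriv f x) (at x)" "cm_upto n (\<lambda>x. - deriv f x)"
    if "\<And>n. cm_upto n f" "x > 0" for f n x
  proof -
    from that(1)[of "Suc n"] obtain h where
      h: "\<And>x. x > 0 \<Longrightarrow> (f has_real_derivative - h x) (at x)" "cm_upto n h" by auto
    show "(f has_real_derivative deriv f x) (at x)"
      using h(1)[OF that(2)] DERIV_imp_deriv by fastforce
    show "cm_upto n (\<lambda>x. - deriv f x)"
      by (rule cm_upto_cong[OF h(2)]) (use h(1) DERIV_imp_deriv in fastforce)
  qed
  have cm: "cm_upto n (D k)" for n k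
  proof (induction k arbitrary: n)
    case 0
    then show ?case using assms by (simp add: D_def)
  next
    case (Suc k)
    show ?case
      \<comment> \<open>The conclusion used does not mention \<open>x\<close>; the value 1 only
        discharges the premise \<open>x > 0\<close>.\<close>
      unfolding D_Suc by (rule step(2)[where x = 1]) (use Suc in auto)
  qed
  show ?thesis
  proof
    show "D 0 = f" by (simp add: D_def)
    show "D k x \<ge> 0" if "x > 0" for k x using cm_upto_nonneg[OF cm that] .
    show "(D k has_real_derivative - D (Suc k) x) (at x)" if "x > 0" for k x
      using step(1)[OF cm that] by (simp add: D_Suc)
  qed
qed

section \<open>Taylor expansion of completely monotone functions\<close>

locale cm_derivs =
  fixes D :: "nat \<Rightarrow> real \<Rightarrow> real"
  assumes nonneg: "x > 0 \<Longrightarrow> D k x \<ge> 0"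
    and deriv: "x > 0 \<Longrightarrow> (D k has_real_derivative - D (Suc k) x) (at x)"
begin

text \<open>The Taylor polynomial of \<open>D 0\<close> with centre \<open>y\<close>, evaluated at
  \<open>z\<close>. The signs of the derivatives sit in \<open>D\<close>, hence the powers of
  \<open>y - z\<close>: for z \<le> y every term is non-negative.\<close>

definition taylor :: "nat \<Rightarrow> real \<Rightarrow> real \<Rightarrow> real" where
  "taylor m z y = (\<Sum>k<m. D k y * (y - z) ^ k / fact k)"

lemma taylor_at_self: "taylor (Suc m) z z = D 0 z"
proof -
  have "taylor (Suc m) z z = (\<Sum>k\<in>{0}. D k z * (z - z) ^ k / fact k)"
    unfolding taylor_def by (rule sum.mono_neutral_right) auto
  then show ?thesis by simp
qed

text \<open>Differentiation in the centre telescopes: each term cancels a part of its neighbour, and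
  only the last one survives.\<close>

lemma taylor_deriv:
  assumes "y > 0"
  shows "(taylor (Suc m) z has_real_derivative - (D (Suc m) y * (y - z) ^ m / fact m)) (at y)"
proof (induction m)
  case 0
  show ?case unfolding taylor_def using deriv[OF assms, of 0] by simp
next
  case (Suc m)
  have eq: "taylor (Suc (Suc m)) z =
      (\<lambda>y. taylor (Suc m) z y + D (Suc m) y * (y - z) ^ Suc m / fact (Suc m))"
    by (auto simp: taylor_def)
  have d: "((\<lambda>y. D (Suc m) y * (y - z) ^ Suc m / fact (Suc m)) has_real_derivative
      (- D (Suc (Suc m)) y * (y - z) ^ Suc m + D (Suc m) y * (real (Suc m) * (y - z) ^ m)) / fact (Suc m)) (at y)"
    by (rule derivative_eq_intros deriv[OF assms] refl | simp)+
  have "D (Suc m) y * (real (Suc m) * (y - z) ^ m) / fact (Suc m) = D (Suc m) y * (y - z) ^ m / fact m"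
    by (simp add: field_simps del: of_nat_Suc)
  then have "- (D (Suc m) y * (y - z) ^ m / fact m) +
      (- D (Suc (Suc m)) y * (y - z) ^ Suc m + D (Suc m) y * (real (Suc m) * (y - z) ^ m)) / fact (Suc m)
      = - (D (Suc (Suc m)) y * (y - z) ^ Suc m / fact (Suc m))"
    by (simp only: add_divide_distrib)
  then show ?case
    unfolding eq using DERIV_add[OF Suc d] by simp
qed

text \<open>At the centre \<open>z\<close> the sum is \<open>D 0 z\<close>, and by
  \<open>taylor_deriv\<close> it does not increase as the centre moves up to
  \<open>y\<close>.\<close>

lemma taylor_le:
  assumes "0 < z" "z \<le> y"
  shows "taylor m z y \<le> D 0 z"
proof (cases m)
  case 0
  then show ?thesis using nonneg assms by (simp add: taylor_def)
next
  case (Suc n)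
  have "taylor (Suc n) z y \<le> taylor (Suc n) z z"
  proof (rule DERIV_nonpos_imp_nonincreasing[OF assms(2)])
    fix x assume "z \<le> x" "x \<le> y"
    then show "\<exists>d. (taylor (Suc n) z has_real_derivative d) (at x) \<and> d \<le> 0"
      using taylor_deriv[of x n z] assms nonneg[of x "Suc n"] by (intro exI conjI) auto
  qed
  then show ?thesis using taylor_at_self Suc by simp
qed

text \<open>Cauchy's form of the remainder at \<open>\<xi>\<close> is compared with a single term of the Taylor sum
  centred at \<open>\<xi>\<close> and evaluated at \<open>w = z / 2\<close>.\<close>

lemma taylor_remainder:
  assumes "0 < z" "z < a"
  shows "D 0 z - taylor (Suc m) z a \<le>
           (a - z) / (z / 2) * D 0 (z / 2) * (real (Suc m) * ((a - z) / (a - z / 2)) ^ m)"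
proof -
  define w where "w = z / 2"
  have w: "0 < w" "w < z" "z - w = z / 2" using assms by (auto simp: w_def)
  obtain x where x: "z < x" "x < a"
    and eq: "taylor (Suc m) z a - taylor (Suc m) z z = (a - z) * (- (D (Suc m) x * (x - z) ^ m / fact m))"
    using MVT2[OF assms(2), of "taylor (Suc m) z" "\<lambda>y. - (D (Suc m) y * (y - z) ^ m / fact m)"]
      taylor_deriv assms by auto
  have "D (Suc m) x * (x - w) ^ Suc m / fact (Suc m) \<le> taylor (Suc (Suc m)) w x"
    using nonneg x w
    unfolding taylor_def by (intro member_le_sum) auto
  also have "\<dots> \<le> D 0 w"
    using taylor_le w x by simp
  finally have 1: "D (Suc m) x \<le> D 0 w * fact (Suc m) / (x - w) ^ Suc m"
    using x w by (simp add: pos_le_divide_eq pos_divide_le_eq del: power_Suc fact_Suc)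
  \<comment> \<open>Since \<open>w < z\<close>, this ratio increases with \<open>x\<close>; its
    value at \<open>a\<close> is a bound independent of the unknown intermediate point.\<close>
  have 2: "(x - z) / (x - w) \<le> (a - z) / (a - w)"
  proof -
    have "(x - z) * (a - w) \<le> (a - z) * (x - w)"
      using mult_nonneg_nonneg[of "a - x" "z - w"] x w by (simp add: algebra_simps)
    then show ?thesis using x w by (simp add: divide_simps)
  qed
  have "D 0 z - taylor (Suc m) z a = (a - z) * (D (Suc m) x * (x - z) ^ m / fact m)"
    using eq taylor_at_self by simp
  also have "\<dots> \<le> (a - z) * (D 0 w * fact (Suc m) / (x - w) ^ Suc m * (x - z) ^ m / fact m)"
    using x w 1 assms by (intro mult_left_mono divide_right_mono mult_right_mono) auto
  also have "\<dots> = (a - z) / (x - w) * D 0 w * (real (Suc m) * ((x - z) / (x - w)) ^ m)"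
    using x w by (simp add: field_simps power_divide del: of_nat_Suc)
  also have "\<dots> \<le> (a - z) / (z - w) * D 0 w * (real (Suc m) * ((a - z) / (a - w)) ^ m)"
    using x w 2 assms nonneg[OF w(1), of 0]
    by (intro mult_mono power_mono mult_left_mono divide_left_mono mult_right_mono) auto
  finally show ?thesis by (simp add: w_def)
qed

lemma taylor_sums:
  assumes "0 < z" "z < a"
  shows "(\<lambda>k. D k a * (a - z) ^ k / fact k) sums D 0 z"
proof -
  \<comment> \<open>\<open>q < 1\<close> because \<open>z / 2 < z\<close>, so the geometric decay in
    \<open>taylor_remainder\<close> beats the factor \<open>Suc m\<close>.\<close>
  define q where "q = (a - z) / (a - z / 2)"
  have q: "0 \<le> q" "q < 1" using assms by (auto simp: q_def)
  have "(\<lambda>m. real (Suc m) * q ^ m) \<longlonglongrightarrow> 0"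
  proof -
    have "(\<lambda>m. real m * q ^ m + q ^ m) \<longlonglongrightarrow> 0 + 0"
      using q by (intro tendsto_add powser_times_n_limit_0 LIMSEQ_power_zero) auto
    then show ?thesis by (simp add: algebra_simps)
  qed
  then have lim: "(\<lambda>m. (a - z) / (z / 2) * D 0 (z / 2) * (real (Suc m) * q ^ m)) \<longlonglongrightarrow> 0"
    using tendsto_mult_right_zero by blast
  have "(\<lambda>m. D 0 z - taylor (Suc m) z a) \<longlonglongrightarrow> 0"
  proof (rule tendsto_sandwich[OF _ _ tendsto_const lim])
    show "\<forall>\<^sub>F m in sequentially. 0 \<le> D 0 z - taylor (Suc m) z a"
      using taylor_le assms by (intro always_eventually) auto
    show "\<forall>\<^sub>F m in sequentially. D 0 z - taylor (Suc m) z a \<le>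
        (a - z) / (z / 2) * D 0 (z / 2) * (real (Suc m) * q ^ m)"
      using taylor_remainder[OF assms] by (intro always_eventually) (auto simp: q_def)
  qed
  then have "(\<lambda>m. D 0 z - (D 0 z - taylor (Suc m) z a)) \<longlonglongrightarrow> D 0 z - 0"
    by (intro tendsto_diff tendsto_const)
  then have "(\<lambda>m. taylor (Suc m) z a) \<longlonglongrightarrow> D 0 z"
    by simp
  then show ?thesis
    unfolding sums_def taylor_def[abs_def] by (rule LIMSEQ_imp_Suc)
qed

end

section \<open>Laplace transforms\<close>

lemma has_laplace_transform_cong:
  assumes "has_laplace_transform f F" "\<And>t. t > 0 \<Longrightarrow> f t = g t" "\<And>s. s > 0 \<Longrightarrow> F s = G s"
  shows "has_laplace_transform g G"
proof -
  have "(\<lambda>t. indicator {0<..} t *\<^sub>R (exp (- s * t) * f t)) =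
        (\<lambda>t. indicator {0<..} t *\<^sub>R (exp (- s * t) * g t))" for s
    using assms(2) by (auto simp: fun_eq_iff split: split_indicator)
  then show ?thesis
    using assms(1,3)
    by (simp add: has_laplace_transform_def laplace_def set_integrable_def set_lebesgue_integral_def)
qed

section \<open>Linearity, monotonicity and step functions\<close>

lemma has_laplace_transform_diff:
  assumes "has_laplace_transform f F" "has_laplace_transform g G"
  shows "has_laplace_transform (\<lambda>t. f t - g t) (\<lambda>s. F s - G s)"
  using assms unfolding has_laplace_transform_def laplace_def
  by (simp add: right_diff_distrib set_integral_diff)

lemma has_laplace_transform_cmult:
  assumes "has_laplace_transform f F"
  shows "has_laplace_transform (\<lambda>t. c * f t) (\<lambda>s. c * F s)"
proof -
  have "(\<lambda>t. exp (- s * t) * (c * f t)) = (\<lambda>t. c * (exp (- s * t) * f t))" for s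
    by (simp add: mult_ac)
  then show ?thesis
    using assms unfolding has_laplace_transform_def laplace_def by simp
qed

lemma has_laplace_transform_mono:
  assumes "has_laplace_transform f F" "has_laplace_transform g G"
    and "\<And>t. t > 0 \<Longrightarrow> f t \<le> g t" "s > 0"
  shows "F s \<le> G s"
proof -
  have "(LINT t:{0<..}|lebesgue. exp (- s * t) * f t) \<le> (LINT t:{0<..}|lebesgue. exp (- s * t) * g t)"
    using assms unfolding has_laplace_transform_def
    by (intro set_integral_mono) auto
  then show ?thesis
    using assms unfolding has_laplace_transform_def laplace_def by simp
qed

lemma has_laplace_transform_step:
  assumes "c \<ge> 0"
  shows "has_laplace_transform (indicator {c..}) (\<lambda>s. exp (- s * c) / s)"
  unfolding has_laplace_transform_def laplace_def
proof (intro allI impI)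
  fix s :: real assume s: "s > 0"
  let ?e = "\<lambda>t. exp (- s * t)"
  have "(?e has_integral exp (- s * c) / s) ({0<..} \<inter> {c..})"
  proof -
    \<comment> \<open>The two domains differ only when \<open>c = 0\<close>, and then only in the
      point 0.\<close>
    have "{x \<in> {c..} - {0<..} \<inter> {c..}. ?e x \<noteq> 0} \<subseteq> {0}"
      using assms by auto
    then have "negligible {x \<in> {c..} - {0<..} \<inter> {c..}. ?e x \<noteq> 0}"
      using negligible_sing negligible_subset by blast
    then show ?thesis
      using has_integral_exp_minus_to_infinity[OF s, of c]
      by (subst has_integral_spike_set_eq[where T = "{c..}"]) auto
  qed
  then have i: "((\<lambda>t. if t \<in> {c..} then ?e t else 0) has_integral exp (- s * c) / s) {0<..}"
    by (subst has_integral_restrict_Int) (simp add: Int_commute)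
  have eq: "(\<lambda>t. if t \<in> {c..} then ?e t else 0) = (\<lambda>t. ?e t * indicator {c..} t)"
    by (auto split: split_indicator)
  have abs: "set_integrable lebesgue {0<..} (\<lambda>t. ?e t * indicator {c..} t)"
    using i unfolding eq by (intro nonnegative_absolutely_integrable_1) (auto simp: integrable_on_def)
  with i show "set_integrable lebesgue {0<..} (\<lambda>t. ?e t * indicator {c..} t) \<and>
      (LINT t:{0<..}|lebesgue. ?e t * indicator {c..} t) = exp (- s * c) / s"
    unfolding eq by (simp add: set_lebesgue_integral_eq_integral(2) integral_unique)
qed

lemma has_laplace_transform_one: "has_laplace_transform (\<lambda>t. 1) (\<lambda>s. 1 / s)"
  by (rule has_laplace_transform_cong[OF has_laplace_transform_step[of 0]]) auto

text \<open>By non-negativity the integrals of the norms are the \<open>H k s\<close> themselves,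
  whose summability justifies exchanging sum and integral.\<close>

lemma has_laplace_transform_suminf:
  assumes h: "\<And>k. has_laplace_transform (h k) (H k)"
    and nonneg: "\<And>k t. t > 0 \<Longrightarrow> h k t \<ge> 0"
    and summable: "\<And>t. t > 0 \<Longrightarrow> summable (\<lambda>k. h k t)" "\<And>s. s > 0 \<Longrightarrow> summable (\<lambda>k. H k s)"
  shows "has_laplace_transform (\<lambda>t. \<Sum>k. h k t) (\<lambda>s. \<Sum>k. H k s)"
  unfolding has_laplace_transform_def laplace_def
proof (intro allI impI)
  fix s :: real assume s: "s > 0"
  let ?f = "\<lambda>k t. indicator {0<..} t *\<^sub>R (exp (- s * t) * h k t)"
  have int: "integrable lebesgue (?f k)" "integral\<^sup>L lebesgue (?f k) = H k s" for k
    using h[of k] s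
    by (simp_all add: has_laplace_transform_def laplace_def set_integrable_def set_lebesgue_integral_def)
  have norm: "norm (?f k t) = ?f k t" for k t
    using nonneg[of t k] by (auto split: split_indicator)
  have sm: "summable (\<lambda>k. ?f k t)" for t
    using summable(1)[of t] by (cases "t > 0") (auto intro!: summable_mult)
  have sum: "(\<Sum>k. ?f k t) = indicator {0<..} t *\<^sub>R (exp (- s * t) * (\<Sum>k. h k t))" for t
    using summable(1)[of t] by (cases "t > 0") (auto simp: suminf_mult)
  have *: "AE t in lebesgue. summable (\<lambda>k. norm (?f k t))"
    "summable (\<lambda>k. \<integral>t. norm (?f k t) \<partial>lebesgue)"
    unfolding norm using sm summable(2)[OF s] int(2) by simp_all
  show "set_integrable lebesgue {0<..} (\<lambda>t. exp (- s * t) * (\<Sum>k. h k t)) \<and>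
        (LINT t:{0<..}|lebesgue. exp (- s * t) * (\<Sum>k. h k t)) = (\<Sum>k. H k s)"
    using integrable_suminf[OF int(1) *, unfolded sum] integral_suminf[OF int(1) *, unfolded sum int(2)]
    by (simp add: set_integrable_def set_lebesgue_integral_def)
qed

text \<open>Dominated convergence with majorant \<open>C * exp (- s * t)\<close>.\<close>

lemma has_laplace_transform_limit:
  assumes G: "\<And>n. has_laplace_transform (G n) (\<Phi> n)"
    and bound: "\<And>n t. t > 0 \<Longrightarrow> \<bar>G n t\<bar> \<le> C"
    and F: "F \<in> borel_measurable lebesgue"
    and conv: "AE t in lebesgue. (\<lambda>n. G n t) \<longlonglongrightarrow> F t"
    and lim: "\<And>s. s > 0 \<Longrightarrow> (\<lambda>n. \<Phi> n s) \<longlonglongrightarrow> \<Psi> s"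
  shows "has_laplace_transform F \<Psi>"
  unfolding has_laplace_transform_def laplace_def
proof (intro allI impI)
  fix s :: real assume s: "s > 0"
  let ?f = "\<lambda>F t. indicator {0<..} t *\<^sub>R (exp (- s * t) * F t)"
  have int: "integrable lebesgue (?f (G n))" "integral\<^sup>L lebesgue (?f (G n)) = \<Phi> n s" for n
    using G[of n] s
    by (simp_all add: has_laplace_transform_def laplace_def set_integrable_def set_lebesgue_integral_def)
  have w: "integrable lebesgue (?f (\<lambda>t. C))"
    using has_laplace_transform_cmult[OF has_laplace_transform_one, of C] s
    by (simp add: has_laplace_transform_def set_integrable_def)
  have "(\<lambda>t. exp (- s * t)) \<in> borel_measurable lebesgue"
    by (intro measurable_completion) auto
  then have m: "?f F \<in> borel_measurable lebesgue"
    using F by (intro borel_measurable_scaleR borel_measurable_times borel_measurable_indicator) auto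
  have c: "AE t in lebesgue. (\<lambda>n. ?f (G n) t) \<longlonglongrightarrow> ?f F t"
    using conv by eventually_elim (intro tendsto_intros)
  have b: "AE t in lebesgue. norm (?f (G n) t) \<le> ?f (\<lambda>t. C) t" for n
    using bound by (intro AE_I2) (auto simp: abs_mult split: split_indicator)
  note dc = m borel_measurable_integrable[OF int(1)] w c b
  have "(\<lambda>n. \<Phi> n s) \<longlonglongrightarrow> integral\<^sup>L lebesgue (?f F)"
    using integral_dominated_convergence[OF dc] int(2) by simp
  then have "integral\<^sup>L lebesgue (?f F) = \<Psi> s"
    using lim[OF s] LIMSEQ_unique by blast
  then show "set_integrable lebesgue {0<..} (\<lambda>t. exp (- s * t) * F t) \<and>
      (LINT t:{0<..}|lebesgue. exp (- s * t) * F t) = \<Psi> s"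
    using integrable_dominated_convergence[OF dc] by (simp add: set_integrable_def set_lebesgue_integral_def)
qed

text \<open>Ensures that \<open>laplace f\<close> is a genuine transform and not the default value
  of a divergent integral.\<close>

lemma has_laplace_transform_bounded:
  assumes "locally_integrable_nonneg f" "\<And>t. t \<ge> 0 \<Longrightarrow> \<bar>f t\<bar> \<le> C"
  shows "has_laplace_transform f (laplace f)"
  unfolding has_laplace_transform_def
proof (intro allI impI conjI refl)
  fix s :: real assume s: "s > 0"
  \<comment> \<open>Local integrability gives measurability on each \<open>{0..real n}\<close>; at
    every point the truncations are eventually constant in \<open>n\<close>.\<close>
  have m: "(\<lambda>t. indicator {0<..} t * f t) \<in> borel_measurable lebesgue"
  proof (rule borel_measurable_LIMSEQ_real)
    show "(\<lambda>t. indicator {0<..} t * (indicator {0..real n} t *\<^sub>R f t)) \<in> borel_measurable lebesgue" for n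
    proof -
      have "set_integrable lebesgue {0..real n} f"
        using assms(1) unfolding locally_integrable_nonneg_def by (auto simp: subset_eq)
      then have "(\<lambda>t. indicator {0..real n} t *\<^sub>R f t) \<in> borel_measurable lebesgue"
        unfolding set_integrable_def by (rule borel_measurable_integrable)
      then show ?thesis
        by (intro borel_measurable_times borel_measurable_indicator) auto
    qed
    show "(\<lambda>n. indicator {0<..} t * (indicator {0..real n} t *\<^sub>R f t)) \<longlonglongrightarrow> indicator {0<..} t * f t" for t
    proof (rule tendsto_eventually)
      obtain m where m: "t \<le> real m" using real_arch_simple by blast
      show "\<forall>\<^sub>F n in sequentially. indicator {0<..} t * (indicator {0..real n} t *\<^sub>R f t) = indicator {0<..} t * f t"
        using eventually_ge_at_top[of m] by eventually_elim (use m in \<open>auto split: split_indicator\<close>)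
    qed
  qed
  have e: "(\<lambda>t. exp (- s * t)) \<in> borel_measurable lebesgue"
    by (intro measurable_completion) auto
  have "integrable lebesgue (\<lambda>t. indicator {0<..} t *\<^sub>R (exp (- s * t) * f t))"
  proof (rule Bochner_Integration.integrable_bound)
    show "integrable lebesgue (\<lambda>t. indicator {0<..} t *\<^sub>R (exp (- s * t) * C))"
      using has_laplace_transform_cmult[OF has_laplace_transform_one, of C] s
      by (simp add: has_laplace_transform_def set_integrable_def)
    show "(\<lambda>t. indicator {0<..} t *\<^sub>R (exp (- s * t) * f t)) \<in> borel_measurable lebesgue"
      using borel_measurable_times[OF e m] by (simp add: mult_ac)
    have "\<bar>f t\<bar> \<le> \<bar>C\<bar>" if "t > 0" for t
      using assms(2)[of t] that by simp
    then show "AE t in lebesgue. norm (indicator {0<..} t *\<^sub>R (exp (- s * t) * f t))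
        \<le> norm (indicator {0<..} t *\<^sub>R (exp (- s * t) * C))"
      by (intro AE_I2) (auto simp: abs_mult split: split_indicator)
  qed
  then show "set_integrable lebesgue {0<..} (\<lambda>t. exp (- s * t) * f t)"
    by (simp add: set_integrable_def)
qed

text \<open>A weak form of the initial value theorem: \<open>f\<close> exceeds \<open>a / 2\<close>
  on some \<open>(0, d)\<close>, and comparison with a step loses at most another factor 2 once s *
  d \<ge> 1.\<close>

lemma laplace_initial_lower_bound:
  assumes F: "has_laplace_transform f F" and "\<And>t. t > 0 \<Longrightarrow> f t \<ge> 0"
    and lim: "(f \<longlongrightarrow> a) (at_right 0)" and "a > 0"
  shows "\<forall>\<^sub>F s in at_top. s * F s \<ge> a / 4"
proof -
  have "\<forall>\<^sub>F t in at_right 0. f t > a / 2"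
    using order_tendstoD(1)[OF lim, of "a / 2"] \<open>a > 0\<close> by simp
  then obtain d where d: "d > 0" "\<And>t. 0 < t \<Longrightarrow> t < d \<Longrightarrow> f t > a / 2"
    unfolding eventually_at_right_field by auto
  have bound: "a / 2 * (1 / s - exp (- s * d) / s) \<le> F s" if "s > 0" for s
  proof (rule has_laplace_transform_mono[OF _ F])
    show "has_laplace_transform (\<lambda>t. a / 2 * (1 - indicator {d..} t))
        (\<lambda>s. a / 2 * (1 / s - exp (- s * d) / s))"
      using d(1) by (intro has_laplace_transform_cmult has_laplace_transform_diff
          has_laplace_transform_one has_laplace_transform_step) auto
    show "a / 2 * (1 - indicator {d..} t) \<le> f t" if "t > 0" for t
      using d(2)[of t] assms(2)[of t] that \<open>a > 0\<close> by (auto split: split_indicator)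
  qed fact
  show ?thesis
    using eventually_ge_at_top[of "1 / d"]
  proof eventually_elim
    case (elim s)
    have s: "s > 0" using elim d(1) by (smt (verit) divide_pos_pos)
    have "1 \<le> s * d" using elim d(1) by (simp add: field_simps)
    then have "1 + 1 \<le> exp (s * d)" using exp_ge_add_one_self[of "s * d"] by linarith
    then have "exp (- s * d) \<le> 1 / 2"
      by (simp add: exp_minus field_simps)
    then have "a / 4 \<le> a / 2 * (1 - exp (- s * d))"
      using \<open>a > 0\<close> by (simp add: field_simps)
    also have "\<dots> = s * (a / 2 * (1 / s - exp (- s * d) / s))"
      using s by (simp add: field_simps)
    also have "\<dots> \<le> s * F s"
      using bound[OF s] s by (intro mult_left_mono) auto
    finally show ?case .
  qed
qed

section \<open>Bernstein's theorem for bounded functions\<close>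

locale bounded_cm_derivs = cm_derivs +
  assumes le_one: "x > 0 \<Longrightarrow> D 0 x \<le> 1"
begin

text \<open>The \<open>k\<close>-th term of the Taylor sum centred at \<open>Suc n\<close> and
  evaluated at 0; \<open>Suc\<close> keeps the centre positive.\<close>

definition weight :: "nat \<Rightarrow> nat \<Rightarrow> real" where
  "weight n k = D k (real (Suc n)) * real (Suc n) ^ k / fact k"

lemma weight_nonneg: "weight n k \<ge> 0"
  by (simp add: weight_def nonneg del: of_nat_Suc)

text \<open>The point 0 lies outside the domain, so \<open>taylor_le\<close> is applied at small
  \<open>z > 0\<close> and \<open>z\<close> tends to 0 in the finite sum.\<close>

lemma weight_sum_le: "(\<Sum>k<m. weight n k) \<le> 1"
proof -
  have eq: "(\<Sum>k<m. weight n k) = taylor m 0 (real (Suc n))"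
    by (simp add: weight_def taylor_def)
  have "((\<lambda>z. taylor m z (real (Suc n))) \<longlongrightarrow> taylor m 0 (real (Suc n))) (at_right 0)"
    unfolding taylor_def by (intro tendsto_intros) auto
  moreover have "\<forall>\<^sub>F z in at_right 0. taylor m z (real (Suc n)) \<le> 1"
  proof -
    have "\<forall>\<^sub>F z in at_right (0::real). z < 1"
      by (rule eventually_at_right_real[of 0 1, THEN eventually_mono]) auto
    then show ?thesis
      using eventually_at_right_less[of 0]
    proof eventually_elim
      case (elim z)
      then show ?case using taylor_le[of z "real (Suc n)" m] le_one[of z] by simp
    qed
  qed
  ultimately show ?thesis
    unfolding eq by (intro tendsto_upperbound) auto
qed

text \<open>The Taylor series at z = N * (1 - x), N = n + 1, has increment N - z = N * x, which
  turns it into a power series in \<open>x\<close>.\<close>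

lemma weight_power_sums:
  assumes "0 < x" "x < 1"
  shows "(\<lambda>k. weight n k * x ^ k) sums D 0 (real (Suc n) * (1 - x))"
proof -
  let ?N = "real (Suc n)"
  have "(\<lambda>k. D k ?N * (?N - ?N * (1 - x)) ^ k / fact k) sums D 0 (?N * (1 - x))"
    by (rule taylor_sums) (use assms in \<open>auto simp: mult_less_cancel_left2\<close>)
  moreover have "?N - ?N * (1 - x) = ?N * x" by (simp add: algebra_simps)
  ultimately show ?thesis
    by (simp add: weight_def power_mult_distrib mult_ac del: of_nat_Suc)
qed

text \<open>The jump at \<open>k / N\<close>, \<open>N = n + 1\<close>, is the \<open>k\<close>-th Taylor coefficient of \<open>D 0\<close> at \<open>N\<close>, so that
  the Laplace-Stieltjes transform of the step function is the Taylor series of \<open>D 0\<close> at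
  \<open>N (1 - exp (- s / N))\<close>, and these points tend to \<open>s\<close>.\<close>

definition step_cdf :: "nat \<Rightarrow> real \<Rightarrow> real" where
  "step_cdf n t = (\<Sum>k<nat (\<lfloor>real (Suc n) * t\<rfloor> + 1). weight n k)"

lemma step_cdf_nonneg: "step_cdf n t \<ge> 0"
  by (simp add: step_cdf_def sum_nonneg weight_nonneg)

lemma step_cdf_le_one: "step_cdf n t \<le> 1"
  by (simp add: step_cdf_def weight_sum_le)

lemma step_cdf_mono: "mono (step_cdf n)"
proof (rule monoI)
  fix x y :: real assume "x \<le> y"
  then have "\<lfloor>real (Suc n) * x\<rfloor> \<le> \<lfloor>real (Suc n) * y\<rfloor>"
    by (intro floor_mono mult_left_mono) auto
  then show "step_cdf n x \<le> step_cdf n y"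
    unfolding step_cdf_def by (intro sum_mono2) (auto simp: weight_nonneg)
qed

lemma step_cdf_right_continuous: "continuous (at_right t) (step_cdf n)"
proof -
  let ?N = "real (Suc n)"
  \<comment> \<open>The next point after \<open>t\<close> where the floor of N * t changes.\<close>
  define b where "b = (of_int \<lfloor>?N * t\<rfloor> + 1) / ?N"
  have b: "t < b"
    using floor_correct[of "?N * t"] by (simp add: b_def field_simps)
  have "\<forall>\<^sub>F x in at_right t. step_cdf n x = step_cdf n t"
    using eventually_at_right_real[OF b]
  proof eventually_elim
    case (elim x)
    have "?N * x < of_int \<lfloor>?N * t\<rfloor> + 1"
      using elim by (simp add: b_def field_simps)
    moreover have "?N * t \<le> ?N * x"
      using elim by (intro mult_left_mono) auto
    ultimately have "\<lfloor>?N * x\<rfloor> = \<lfloor>?N * t\<rfloor>"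
      by (intro floor_unique order_trans[OF of_int_floor_le])
    then show ?case by (simp add: step_cdf_def)
  qed
  then show ?thesis
    unfolding continuous_within by (rule tendsto_eventually)
qed

lemma step_cdf_sums:
  "(\<lambda>k. weight n k * indicator {real k / real (Suc n)..} t) sums step_cdf n t"
proof -
  let ?N = "real (Suc n)"
  \<comment> \<open>The \<open>+ 1\<close> counts the jump at 0; for negative \<open>t\<close>,
    \<open>nat\<close> truncates to 0 and the sum is empty.\<close>
  have "k < nat (\<lfloor>?N * t\<rfloor> + 1) \<longleftrightarrow> real k / ?N \<le> t" for k
  proof -
    have "k < nat (\<lfloor>?N * t\<rfloor> + 1) \<longleftrightarrow> int k \<le> \<lfloor>?N * t\<rfloor>" by linarith
    also have "\<dots> \<longleftrightarrow> real k \<le> ?N * t" by (simp add: le_floor_iff)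
    also have "\<dots> \<longleftrightarrow> real k / ?N \<le> t" by (simp add: field_simps)
    finally show ?thesis .
  qed
  then have "(\<lambda>k. weight n k * indicator {real k / ?N..} t) =
      (\<lambda>k. if k \<in> {..<nat (\<lfloor>?N * t\<rfloor> + 1)} then weight n k else 0)"
    by (auto simp: fun_eq_iff split: split_indicator)
  then show ?thesis
    unfolding step_cdf_def using sums_If_finite_set[of "{..<nat (\<lfloor>?N * t\<rfloor> + 1)}" "weight n"] by simp
qed

lemma step_cdf_laplace:
  "has_laplace_transform (step_cdf n) (\<lambda>s. D 0 (real (Suc n) * (1 - exp (- s / real (Suc n)))) / s)"
proof -
  let ?N = "real (Suc n)"
  define H where "H = (\<lambda>k s. weight n k * (exp (- s * (real k / ?N)) / s))"
  have H: "(\<lambda>k. H k s) sums (D 0 (?N * (1 - exp (- s / ?N))) / s)" if "s > 0" for s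
  proof -
    \<comment> \<open>The transforms of the steps are powers of x = exp (- s / N), so their weighted
      series is that of \<open>weight_power_sums\<close>.\<close>
    have "exp (- s * (real k / ?N)) = exp (- s / ?N) ^ k" for k
      by (simp add: exp_of_nat_mult[symmetric] mult_ac)
    moreover have "exp (- s / ?N) < 1" using that by simp
    ultimately show ?thesis
      using sums_divide[OF weight_power_sums[of "exp (- s / ?N)" n], of s] by (simp add: H_def)
  qed
  have "has_laplace_transform (\<lambda>t. \<Sum>k. weight n k * indicator {real k / ?N..} t) (\<lambda>s. \<Sum>k. H k s)"
  proof (rule has_laplace_transform_suminf)
    show "has_laplace_transform (\<lambda>t. weight n k * indicator {real k / ?N..} t) (H k)" for k
      unfolding H_def by (intro has_laplace_transform_cmult has_laplace_transform_step) auto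
    show "summable (\<lambda>k. weight n k * indicator {real k / ?N..} t)" for t
      using step_cdf_sums by (rule sums_summable)
    show "summable (\<lambda>k. H k s)" if "s > 0" for s
      using H[OF that] by (rule sums_summable)
  qed (simp add: weight_nonneg)
  then show ?thesis
    by (rule has_laplace_transform_cong)
       (use step_cdf_sums[THEN sums_unique] H[THEN sums_unique] in auto)
qed

lemma step_cdf_laplace_tendsto:
  assumes "s > 0"
  shows "(\<lambda>n. D 0 (real (Suc n) * (1 - exp (- s / real (Suc n)))) / s) \<longlonglongrightarrow> D 0 s / s"
proof -
  \<comment> \<open>N * (1 - exp (- s / N)) is the difference quotient at 0 of this function with
    increment 1 / N.\<close>
  have "((\<lambda>h. - exp (- s * h)) has_real_derivative s) (at 0)"
    by (auto intro!: derivative_eq_intros)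
  then have "((\<lambda>h. (1 - exp (- s * h)) / h) \<longlongrightarrow> s) (at 0)"
    by (simp add: DERIV_def)
  moreover have "filterlim (\<lambda>n. inverse (real (Suc n))) (at 0) sequentially"
    by (intro filterlim_atI LIMSEQ_inverse_real_of_nat always_eventually) auto
  ultimately have "(\<lambda>n. (1 - exp (- s * inverse (real (Suc n)))) / inverse (real (Suc n))) \<longlonglongrightarrow> s"
    by (rule filterlim_compose)
  then have "(\<lambda>n. real (Suc n) * (1 - exp (- s / real (Suc n)))) \<longlonglongrightarrow> s"
    by (simp add: field_simps)
  then show ?thesis
    using isCont_tendsto_compose[OF DERIV_isCont[OF deriv[OF assms, of 0]]] assms
    by (intro tendsto_divide tendsto_const) auto
qed

theorem laplace_representation:
  obtains F where "mono F" "\<And>x. continuous (at_right x) F" "\<And>t. F t \<ge> 0" "\<And>t. F t \<le> 1"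
    "has_laplace_transform F (\<lambda>s. D 0 s / s)"
proof -
  have bound: "\<bar>step_cdf n t\<bar> \<le> 1" for n t
    using step_cdf_nonneg[of n t] step_cdf_le_one[of n t] by simp
  from Helly_selection[of step_cdf, OF step_cdf_right_continuous step_cdf_mono bound]
  obtain r F where r: "strict_mono (r :: nat \<Rightarrow> nat)"
      and F: "\<And>x. continuous (at_right x) F" "mono F" "\<And>x. \<bar>F x\<bar> \<le> 1"
      and conv: "\<And>x. isCont F x \<Longrightarrow> (\<lambda>n. step_cdf (r n) x) \<longlonglongrightarrow> F x"
    by (elim exE conjE) (rule that, auto)
  have "F t \<ge> 0" for t
  proof -
    \<comment> \<open>A monotone function has countably many discontinuities, so there is a
      continuity point below \<open>t\<close>, where Helly's convergence holds.\<close>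
    obtain y where y: "y < t" "isCont F y"
      using open_minus_countable[OF mono_ctble_discont[OF F(2)], of "{..<t}"] by auto
    have "F y \<ge> 0"
      using conv[OF y(2)] by (rule LIMSEQ_le_const) (auto simp: step_cdf_nonneg)
    also have "F y \<le> F t"
      using monoD[OF F(2), of y t] y(1) by simp
    finally show ?thesis .
  qed
  moreover have "has_laplace_transform F (\<lambda>s. D 0 s / s)"
  proof (rule has_laplace_transform_limit[where C = 1])
    show "has_laplace_transform (step_cdf (r n))
        (\<lambda>s. D 0 (real (Suc (r n)) * (1 - exp (- s / real (Suc (r n))))) / s)" for n
      by (rule step_cdf_laplace)
    show "\<bar>step_cdf (r n) t\<bar> \<le> 1" for n t by (rule bound)
    show "F \<in> borel_measurable lebesgue"
      using borel_measurable_mono[OF F(2)] by (intro measurable_completion) simp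
    \<comment> \<open>Countability also makes the exceptional set null, so convergence holds almost
      everywhere.\<close>
    have "{a. \<not> isCont F a} \<in> null_sets lebesgue"
      using mono_ctble_discont[OF F(2)] by (intro null_sets_completionI countable_imp_null_set_lborel)
    then have "AE t in lebesgue. t \<notin> {a. \<not> isCont F a}"
      by (rule AE_not_in)
    then show "AE t in lebesgue. (\<lambda>n. step_cdf (r n) t) \<longlonglongrightarrow> F t"
      by eventually_elim (auto intro: conv)
    show "(\<lambda>n. D 0 (real (Suc (r n)) * (1 - exp (- s / real (Suc (r n))))) / s) \<longlonglongrightarrow> D 0 s / s"
      if "s > 0" for s
      using LIMSEQ_subseq_LIMSEQ[OF step_cdf_laplace_tendsto[OF that] r] by (simp add: o_def)
  qed
  ultimately show ?thesis
    using F(1,2) abs_le_D1[OF F(3)] by (intro that[of F]) auto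
qed

end

section \<open>The relaxation equation\<close>

theorem theorem3p1:
  fixes lam :: real and \<alpha> :: "real \<Rightarrow> real" and \<alpha>' \<alpha>'' :: real
  assumes "lam > 0"
    and "\<And>t. t \<ge> 0 \<Longrightarrow> \<alpha> t \<in> {0<..<1}"
    and "locally_integrable_nonneg \<alpha>"
    and "\<alpha>' \<in> {0<..<1}" and "\<alpha>'' \<in> {0<..<1}"
    and "(\<alpha> \<longlongrightarrow> \<alpha>') (at_right 0)"
    and "(\<alpha> \<longlongrightarrow> \<alpha>'') at_top"
    and "bernstein (\<lambda>s. s powr (s * laplace \<alpha> s))"
  shows "\<exists>u. relaxation_solution lam (laplace \<alpha>) u \<and>
           (\<forall>t>0. u t \<ge> 0) \<and>
           antimono_on {0<..} u \<and>
           (\<forall>t>0. continuous (at_right t) u) \<and>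
           (u \<longlongrightarrow> 1) (at_right 0)"
proof -
  define g where "g = (\<lambda>s. s powr (s * laplace \<alpha> s))"
  have g_pos: "g s > 0" if "s > 0" for s
    using that by (simp add: g_def)
  have g_top: "filterlim g at_top at_top"
  proof (rule filterlim_at_top_mono)
    \<comment> \<open>The minorant is \<open>s powr (\<alpha>' / 4)\<close>, with the constant from
      \<open>laplace_initial_lower_bound\<close>.\<close>
    show "filterlim (\<lambda>s. exp (\<alpha>' / 4 * ln s)) at_top at_top"
      using assms(4)
      by (intro filterlim_compose[OF exp_at_top] filterlim_tendsto_pos_mult_at_top[OF tendsto_const _ ln_at_top]) auto
    have "\<bar>\<alpha> t\<bar> \<le> 1" if "t \<ge> 0" for t
      using assms(2)[OF that] by simp
    then have "has_laplace_transform \<alpha> (laplace \<alpha>)"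
      by (rule has_laplace_transform_bounded[OF assms(3)])
    then have "\<forall>\<^sub>F s in at_top. s * laplace \<alpha> s \<ge> \<alpha>' / 4"
      using assms(2,4,6) by (intro laplace_initial_lower_bound) (auto simp: less_imp_le)
    then show "\<forall>\<^sub>F s in at_top. exp (\<alpha>' / 4 * ln s) \<le> g s"
      \<comment> \<open>From s \<ge> 1 on, \<open>ln s\<close> is non-negative and the bound on the
        exponent may be multiplied by it.\<close>
      using eventually_ge_at_top[of 1]
    proof eventually_elim
      case (elim s)
      then have "\<alpha>' / 4 * ln s \<le> s * laplace \<alpha> s * ln s"
        by (intro mult_right_mono) auto
      then show ?case
        using elim by (simp add: g_def powr_def)
    qed
  qed
  define f where "f = (\<lambda>s. lam / (lam + g s))"
  have "cm_upto n f" for n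
  proof -
    have g: "bernstein g"
      using assms(8) by (simp add: g_def)
    have "((\<lambda>s. lam + g s) has_real_derivative deriv g s) (at s)" if "s > 0" for s
    proof -
      have "(g has_real_derivative deriv g s) (at s)"
        using g that unfolding bernstein_def DERIV_deriv_iff_real_differentiable by (metis funpow_0)
      then show ?thesis by (auto intro!: derivative_eq_intros)
    qed
    then have "cm_upto n (\<lambda>s. lam * (1 / (lam + g s)))"
      using assms(1) g_pos
      by (intro cm_upto_mult cm_upto_const cm_upto_inverse[where q = "deriv g"] bernstein_imp_cm_deriv g)
         (auto intro: add_pos_pos)
    then show ?thesis by (simp add: f_def)
  qed
  then obtain D where D: "D 0 = f" "\<And>k x. x > 0 \<Longrightarrow> D k x \<ge> 0"
      "\<And>k x. x > 0 \<Longrightarrow> (D k has_real_derivative - D (Suc k) x) (at x)"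
    by (rule cm_upto_derivs) blast
  interpret bounded_cm_derivs D
    by unfold_locales (use D g_pos assms(1) in \<open>auto simp: f_def add_pos_pos less_imp_le\<close>)
  obtain F where F: "mono F" "\<And>x. continuous (at_right x) F" "\<And>t. F t \<ge> 0" "\<And>t. F t \<le> 1"
      "has_laplace_transform F (\<lambda>s. f s / s)"
    using laplace_representation unfolding D(1) by blast
  \<comment> \<open>Monotonicity gives F t \<ge> F 0 for \<open>t > 0\<close>; comparing transforms
    yields F 0 \<le> f s, and \<open>f s\<close> tends to 0.\<close>
  have "F 0 \<le> 0"
  proof (rule tendsto_lowerbound)
    show "(f \<longlongrightarrow> 0) at_top"
      unfolding f_def
      by (rule tendsto_divide_0[OF tendsto_const])
         (intro filterlim_at_top_imp_at_infinity filterlim_tendsto_add_at_top[OF tendsto_const g_top])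
    show "\<forall>\<^sub>F s in at_top. F 0 \<le> f s"
      using eventually_gt_at_top[of 0]
    proof eventually_elim
      case (elim s)
      have "F 0 * (1 / s) \<le> f s / s"
      proof (rule has_laplace_transform_mono[OF has_laplace_transform_cmult[OF has_laplace_transform_one] F(5)])
        show "F 0 * 1 \<le> F t" if "t > 0" for t
          using monoD[OF F(1), of 0 t] that by simp
      qed fact
      then show ?case using elim by (simp add: divide_le_cancel)
    qed
  qed simp
  then have F0: "F 0 = 0" using F(3)[of 0] by simp
  have sol: "relaxation_solution lam (laplace \<alpha>) (\<lambda>t. 1 - F t)"
    unfolding relaxation_solution_def
  proof (rule has_laplace_transform_cong[OF has_laplace_transform_diff[OF has_laplace_transform_one F(5)]])
    fix s :: real assume s: "s > 0"
    have "s powr (s * laplace \<alpha> s - 1) = g s / s"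
      using s by (simp add: g_def powr_diff)
    moreover have "1 / s - f s / s = g s / s / (lam + g s)"
    proof -
      have "1 - f s = g s / (lam + g s)"
        using g_pos[OF s] assms(1) by (simp add: f_def divide_simps)
      then have "(1 - f s) / s = g s / s / (lam + g s)"
        by (simp add: mult_ac)
      then show ?thesis
        by (simp add: diff_divide_distrib)
    qed
    ultimately show "1 / s - f s / s = s powr (s * laplace \<alpha> s - 1) / (lam + s powr (s * laplace \<alpha> s))"
      by (simp add: g_def)
  qed simp
  \<comment> \<open>Right-continuity of \<open>F\<close> at 0 turns \<open>F 0 = 0\<close> into the
    initial condition.\<close>
  have "((\<lambda>t. 1 - F t) \<longlongrightarrow> 1 - F 0) (at_right 0)"
    using F(2)[of 0] unfolding continuous_within by (intro tendsto_intros)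
  then show ?thesis
    using sol F F0
    by (intro exI[of _ "\<lambda>t. 1 - F t"])
       (auto intro!: continuous_intros monotone_onI monoD[OF F(1)])
qed

end
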